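(* Let $W\ge 3$ be an integer, let $\phi_2=-1$ and let $\phi_1\in\mathbb{R}$ with $|\phi_1|\ge 2$. Let $\mathsf{w}_0,\mathsf{w}_1,\mathsf{w}_2$ be the generating functions of the diagonals number $0,1,2$ of the AR(2) matrix $\mathbf{W}$ with parameters $\phi_1,\phi_2$ (see context). Put $$z_1=\frac{-\phi_1+\sqrt{\phi_1^2-4}}{2},\qquad z_2=\frac{-\phi_1-\sqrt{\phi_1^2-4}}{2}.$$ Then the system of polynomial identities $$\mathsf{w}_2(t)=\mathsf{a}_1(t)\mathsf{b}_1(t),\quad \mathsf{w}_1(t)=\mathsf{a}_0(t)\mathsf{b}_1(t)+\mathsf{a}_1(t)\mathsf{b}_0(t),\quad \mathsf{w}_0(t)=\mathsf{a}_0(t)\mathsf{b}_0(t)+2t\,\mathsf{a}_1(t)\mathsf{b}_1(t)$$ has solutions in real polynomials $\mathsf{a}_0,\mathsf{a}_1,\mathsf{b}_0,\mathsf{b}_1$. Specifically, for any factorization $1+t+\dots+t^{W-2}=\mathsf{p}(t)\mathsf{q}(t)$ into a product of two non-zero real polynomials, a solution is obtained by setting $\mathsf{a}_1(t)=\mathsf{p}(t)$, $\mathsf{b}_1(t)=\mathsf{q}(t)$ and either $$\mathsf{a}_0(t)=(z_2+z_1t)\mathsf{p}(t),\quad \mathsf{b}_0(t)=(z_1+z_2t)\mathsf{q}(t),$$ or $$\mathsf{a}_0(t)=(z_1+z_2t)\mathsf{p}(t),\quad \mathsf{b}_0(t)=(z_2+z_1t)\mathsf{q}(t).$$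
   Context: AR(2) matrix: for $W\ge 3$, $\mathbf{W}=(w_{i,j})_{i,j=0}^{W}$ is the symmetric matrix with $w_{i,j}=0$ for $|i-j|>2$ such that - $w_{i,i+2}=-\phi_2$ for $0\le i\le W-2$; - $w_{0,1}=w_{W-1,W}=-\phi_1$ and $w_{i,i+1}=-\phi_1+\phi_1\phi_2$ for $1\le i\le W-2$; - $w_{0,0}=w_{W,W}=1$, $w_{1,1}=w_{W-1,W-1}=1+\phi_1^2$, and $w_{i,i}=1+\phi_1^2+\phi_2^2$ for $2\le i\le W-2$. Generating function of its $k$-th diagonal ($k\ge 0$): $\mathsf{w}_k(t)=\sum_{j=0}^{W-k}w_{j,j+k}t^j$. The displayed system expresses $\mathbf{W}=\mathbf{A}\ast\mathbf{B}$ (matrix convolution) for symmetric 3-diagonal matrices $\mathbf{A},\mathbf{B}$ whose diagonals number $0$ and $1$ have generating functions $\mathsf{a}_0,\mathsf{a}_1$ and $\mathsf{b}_0,\mathsf{b}_1$ respectively. *)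

theory Defs
  imports Complex_Main "HOL-Computational_Algebra.Polynomial" "Jordan_Normal_Form.Matrix"
begin

definition ar2_matrix :: "nat \<Rightarrow> real \<Rightarrow> real \<Rightarrow> real mat" where
  "ar2_matrix W \<phi>1 \<phi>2 = mat (W + 1) (W + 1) (\<lambda>(i, j).
     let k = min i j; l = max i j in
       if l = k then
         (if k = 0 \<or> k = W then 1
          else if k = 1 \<or> k = W - 1 then 1 + \<phi>1\<^sup>2
          else 1 + \<phi>1\<^sup>2 + \<phi>2\<^sup>2)
       else if l = k + 1 then
         (if k = 0 \<or> l = W then - \<phi>1 else - \<phi>1 + \<phi>1 * \<phi>2)
       else if l = k + 2 then - \<phi>2
       else 0)"

lemma ar2_matrix_entries:
  assumes "W \<ge> 3"
  shows "i \<le> W \<Longrightarrow> j \<le> W \<Longrightarrow> ar2_matrix W \<phi>1 \<phi>2 $$ (i, j) = ar2_matrix W \<phi>1 \<phi>2 $$ (j, i)"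
    and "i \<le> W \<Longrightarrow> j \<le> W \<Longrightarrow> \<bar>int i - int j\<bar> > 2 \<Longrightarrow> ar2_matrix W \<phi>1 \<phi>2 $$ (i, j) = 0"
    and "i \<le> W - 2 \<Longrightarrow> ar2_matrix W \<phi>1 \<phi>2 $$ (i, i + 2) = - \<phi>2"
    and "ar2_matrix W \<phi>1 \<phi>2 $$ (0, 1) = - \<phi>1"
    and "ar2_matrix W \<phi>1 \<phi>2 $$ (W - 1, W) = - \<phi>1"
    and "1 \<le> i \<Longrightarrow> i \<le> W - 2 \<Longrightarrow> ar2_matrix W \<phi>1 \<phi>2 $$ (i, i + 1) = - \<phi>1 + \<phi>1 * \<phi>2"
    and "ar2_matrix W \<phi>1 \<phi>2 $$ (0, 0) = 1"
    and "ar2_matrix W \<phi>1 \<phi>2 $$ (W, W) = 1"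
    and "ar2_matrix W \<phi>1 \<phi>2 $$ (1, 1) = 1 + \<phi>1\<^sup>2"
    and "ar2_matrix W \<phi>1 \<phi>2 $$ (W - 1, W - 1) = 1 + \<phi>1\<^sup>2"
    and "2 \<le> i \<Longrightarrow> i \<le> W - 2 \<Longrightarrow> ar2_matrix W \<phi>1 \<phi>2 $$ (i, i) = 1 + \<phi>1\<^sup>2 + \<phi>2\<^sup>2"
  using assms by (auto simp: ar2_matrix_def Let_def min_def max_def)

text \<open>For a matrix with rows \<open>0, \<dots>, W\<close> the summation index runs over \<open>0 \<le> j \<le> W - k\<close>.\<close>

definition diag_gf :: "'a::comm_monoid_add mat \<Rightarrow> nat \<Rightarrow> 'a poly" where
  "diag_gf M k = (\<Sum>j<dim_row M - k. monom (M $$ (j, j + k)) j)"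

text \<open>The identities that express a symmetric 5-diagonal matrix, with diagonals generated by
  \<open>w0, w1, w2\<close>, as the convolution of two symmetric 3-diagonal matrices, with diagonals
  generated by \<open>a0, a1\<close> and \<open>b0, b1\<close>.\<close>

definition convolution_system ::
    "real poly \<Rightarrow> real poly \<Rightarrow> real poly \<Rightarrow> real poly \<Rightarrow> real poly \<Rightarrow> real poly \<Rightarrow> real poly \<Rightarrow> bool" where
  "convolution_system w0 w1 w2 a0 a1 b0 b1 \<longleftrightarrow>
     w2 = a1 * b1 \<and>
     w1 = a0 * b1 + a1 * b0 \<and>
     w0 = a0 * b0 + 2 * [:0, 1:] * a1 * b1"

end

theory Submission
  imports Defs
begin

text \<open>For \<open>\<phi>2 = -1\<close> all three diagonals are multiples of \<open>s = 1 + t + \<dots> + t\<^sup>W\<^sup>-\<^sup>2\<close>: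
  \<open>w2 = s\<close>, \<open>w1 = -\<phi>1 (1 + t) s\<close> and \<open>w0 = (1 + \<phi>1\<^sup>2 t + t\<^sup>2) s\<close>. As \<open>z1 + z2 = -\<phi>1\<close> and
  \<open>z1 z2 = 1\<close>, the linear factors \<open>z2 + z1 t\<close> and \<open>z1 + z2 t\<close> have sum \<open>-\<phi>1 (1 + t)\<close> and product
  \<open>1 + (\<phi>1\<^sup>2 - 2) t + t\<^sup>2\<close>, which makes the system hold for every splitting \<open>s = p q\<close>.\<close>

lemma coeff_diag_gf:
  "coeff (diag_gf M k) n = (if n < dim_row M - k then M $$ (n, n + k) else 0)"
  by (auto simp: diag_gf_def coeff_sum)

lemma coeff_geometric_poly:
  "coeff (\<Sum>j=0..m. monom (1::'a::comm_semiring_1) j) n = (if n \<le> m then 1 else 0)"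
  by (auto simp: coeff_sum)

text \<open>Each coefficient of a product with \<open>s\<close> is a sum of consecutive coefficients
  of the other factor. Inside the band it is the full sum, \<open>2 + \<phi>1\<^sup>2\<close> or
  \<open>-2 * \<phi>1\<close>; truncation at both ends yields the exceptional corner
  entries.\<close>

lemma diag_gf_ar2_matrix_minus_one:
  fixes \<phi>1 :: real
  assumes "W \<ge> 3"
  defines "s \<equiv> \<Sum>j=0..W-2. monom (1::real) j"
  shows "diag_gf (ar2_matrix W \<phi>1 (-1)) 0 = [:1, \<phi>1\<^sup>2, 1:] * s"
    and "diag_gf (ar2_matrix W \<phi>1 (-1)) 1 = [:- \<phi>1, - \<phi>1:] * s"
    and "diag_gf (ar2_matrix W \<phi>1 (-1)) 2 = s"
proof -
  have s: "coeff s n = (if n \<le> W - 2 then 1 else 0)" for n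
    unfolding s_def by (rule coeff_geometric_poly)
  show "diag_gf (ar2_matrix W \<phi>1 (-1)) 0 = [:1, \<phi>1\<^sup>2, 1:] * s"
    using \<open>W \<ge> 3\<close>
    by (intro poly_eqI)
      (auto simp: coeff_diag_gf s ar2_matrix_def Let_def coeff_pCons split: nat.splits)
  show "diag_gf (ar2_matrix W \<phi>1 (-1)) 1 = [:- \<phi>1, - \<phi>1:] * s"
    using \<open>W \<ge> 3\<close>
    by (intro poly_eqI)
      (auto simp: coeff_diag_gf s ar2_matrix_def Let_def coeff_pCons split: nat.splits)
  show "diag_gf (ar2_matrix W \<phi>1 (-1)) 2 = s"
    using \<open>W \<ge> 3\<close>
    by (intro poly_eqI) (auto simp: coeff_diag_gf s ar2_matrix_def Let_def)
qed

lemma convolution_system_linear_multiples: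
  fixes x y :: real
  assumes "x * y = 1"
  shows "convolution_system ([:1, (x + y)\<^sup>2, 1:] * (p * q)) ([:x + y, x + y:] * (p * q)) (p * q)
    ([:x, y:] * p) p ([:y, x:] * q) q"
proof -
  have "[:x + y, x + y:] = [:x, y:] + [:y, x:]"
    by simp
  \<comment> \<open>The middle coefficient of the product is
    \<open>x\<^sup>2 + y\<^sup>2 = (x + y)\<^sup>2 - 2\<close>; the missing \<open>2t\<close> is
    supplied by the term \<open>2t a1 b1\<close> of the system.\<close>
  moreover have "[:1, (x + y)\<^sup>2, 1:] = [:x, y:] * [:y, x:] + 2 * [:0, 1:]"
    using assms by (simp add: power2_eq_square algebra_simps numeral_poly)
  ultimately show ?thesis
    unfolding convolution_system_def by (simp only:) (simp only: algebra_simps simp_thms)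
qed

theorem corollary4:
  fixes W :: nat and \<phi>1 \<phi>2 z1 z2 :: real and w0 w1 w2 :: "real poly"
  assumes "W \<ge> 3"
    and "\<phi>2 = -1"
    and "\<bar>\<phi>1\<bar> \<ge> 2"
    and "w0 = diag_gf (ar2_matrix W \<phi>1 \<phi>2) 0"
    and "w1 = diag_gf (ar2_matrix W \<phi>1 \<phi>2) 1"
    and "w2 = diag_gf (ar2_matrix W \<phi>1 \<phi>2) 2"
    and "z1 = (- \<phi>1 + sqrt (\<phi>1\<^sup>2 - 4)) / 2"
    and "z2 = (- \<phi>1 - sqrt (\<phi>1\<^sup>2 - 4)) / 2"
  shows "(\<exists>a0 a1 b0 b1 :: real poly. convolution_system w0 w1 w2 a0 a1 b0 b1) \<and>
    (\<forall>p q :: real poly. p \<noteq> 0 \<longrightarrow> q \<noteq> 0 \<longrightarrow> (\<Sum>j=0..W-2. monom 1 j) = p * q \<longrightarrow>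
       convolution_system w0 w1 w2 ([:z2, z1:] * p) p ([:z1, z2:] * q) q \<and>
       convolution_system w0 w1 w2 ([:z1, z2:] * p) p ([:z2, z1:] * q) q)"
proof -
  \<comment> \<open>The radicand is nonnegative, so \<open>z1\<close> and \<open>z2\<close> are the
    real roots of \<open>x\<^sup>2 + \<phi>1 x + 1\<close>.\<close>
  have "2\<^sup>2 \<le> \<bar>\<phi>1\<bar>\<^sup>2"
    using \<open>\<bar>\<phi>1\<bar> \<ge> 2\<close> by (intro power_mono) auto
  then have "(sqrt (\<phi>1\<^sup>2 - 4))\<^sup>2 = \<phi>1\<^sup>2 - 4"
    by simp
  then have prod: "z1 * z2 = 1"
    unfolding assms(7,8) by (simp add: power2_eq_square field_simps)
  have sum: "z1 + z2 = - \<phi>1"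
    unfolding assms(7,8) by (simp add: field_simps)
  have sys: "convolution_system w0 w1 w2 ([:z2, z1:] * p) p ([:z1, z2:] * q) q \<and>
       convolution_system w0 w1 w2 ([:z1, z2:] * p) p ([:z2, z1:] * q) q"
    if "(\<Sum>j=0..W-2. monom 1 j) = p * q" for p q
    using convolution_system_linear_multiples[of z1 z2 p q]
      convolution_system_linear_multiples[of z2 z1 p q] prod sum
      diag_gf_ar2_matrix_minus_one[OF \<open>W \<ge> 3\<close>, of \<phi>1] that assms(2,4-6)
    by (simp add: ac_simps)
  \<comment> \<open>Existence comes from the trivial factorization with
    \<open>p = 1\<close>.\<close>
  from sys[of 1 "\<Sum>j=0..W-2. monom 1 j"] sys show ?thesis
    by (metis mult_1)
qed

end
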